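(* Let $n\in\mathbb{N}$, and let $T\in\mathbb{B}(\mathcal{H})$ be an $n$-power quasinormal operator. Then $T$ has the single-valued extension property.
   Context: $\mathbb{N}$ denotes the positive integers. $\mathbb{B}(\mathcal{H})$ is the algebra of bounded linear operators on a complex Hilbert space $\mathcal{H}$. $T$ is $n$-power quasinormal if $T^n(T^*T)=(T^*T)T^n$. An operator $T\in\mathbb{B}(\mathcal{H})$ has the single-valued extension property if, for every open set $U\subseteq\mathbb{C}$, the only analytic function $f:U\to\mathcal{H}$ satisfying $(T-zI)f(z)=0$ for all $z\in U$ is the zero function. *)

theory Defs
  imports "HOL-Analysis.Analysis"
begin

text \<open>The inner product is linear in its first argument. Norm, metric, topology and completeness
  are those of \<^class>\<open>banach\<close>; they are tied to the complex structure by the axioms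
  \<open>scaleR_scaleC\<close> and \<open>cinner_self\<close>, the latter also giving positive definiteness.\<close>

class complex_hilbert_space = banach +
  fixes scaleC :: "complex \<Rightarrow> 'a \<Rightarrow> 'a" (infixr "*\<^sub>C" 75)
    and cinner :: "'a \<Rightarrow> 'a \<Rightarrow> complex"
  assumes scaleC_add_right: "c *\<^sub>C (x + y) = c *\<^sub>C x + c *\<^sub>C y"
    and scaleC_add_left: "(c + d) *\<^sub>C x = c *\<^sub>C x + d *\<^sub>C x"
    and scaleC_scaleC: "c *\<^sub>C (d *\<^sub>C x) = (c * d) *\<^sub>C x"
    and scaleC_one: "1 *\<^sub>C x = x"
    and scaleR_scaleC: "r *\<^sub>R x = complex_of_real r *\<^sub>C x"
    and cinner_commute: "cinner x y = cnj (cinner y x)"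
    and cinner_add_left: "cinner (x + y) z = cinner x z + cinner y z"
    and cinner_scaleC_left: "cinner (c *\<^sub>C x) y = c * cinner x y"
    and cinner_self: "cinner x x = complex_of_real ((norm x)\<^sup>2)"

instantiation complex :: complex_hilbert_space
begin

definition scaleC_complex :: "complex \<Rightarrow> complex \<Rightarrow> complex"
  where "scaleC_complex c x = c * x"

definition cinner_complex :: "complex \<Rightarrow> complex \<Rightarrow> complex"
  where "cinner_complex x y = x * cnj y"

instance
  by standard
    (simp_all add: scaleC_complex_def cinner_complex_def algebra_simps scaleR_conv_of_real
      flip: complex_norm_square)

end

definition bounded_clinear :: "('a::complex_hilbert_space \<Rightarrow> 'a) \<Rightarrow> bool"
  where "bounded_clinear T \<longleftrightarrow> bounded_linear T \<and> (\<forall>c x. T (c *\<^sub>C x) = c *\<^sub>C T x)"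

text \<open>For bounded operators the adjoint exists (by the Riesz representation theorem) and is unique,
  and it is automatically bounded and complex linear.\<close>

definition cadjoint :: "('a::complex_hilbert_space \<Rightarrow> 'a) \<Rightarrow> 'a \<Rightarrow> 'a"
  where "cadjoint T = (THE S. \<forall>x y. cinner (T x) y = cinner x (S y))"

definition power_quasinormal :: "nat \<Rightarrow> ('a::complex_hilbert_space \<Rightarrow> 'a) \<Rightarrow> bool"
  where "power_quasinormal n T \<longleftrightarrow>
    (T ^^ n) \<circ> (cadjoint T \<circ> T) = (cadjoint T \<circ> T) \<circ> (T ^^ n)"

text \<open>The Hilbert-space-valued version of \<^const>\<open>analytic_on\<close>, which only covers functions into
  a field: complex differentiability in a neighbourhood of every point of the set.\<close>

definition hilbert_analytic_on ::
    "(complex \<Rightarrow> 'a::complex_hilbert_space) \<Rightarrow> complex set \<Rightarrow> bool"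
  where "hilbert_analytic_on f S \<longleftrightarrow>
    (\<forall>z\<in>S. \<exists>e>0. \<forall>w\<in>ball z e. \<exists>D. (f has_derivative (\<lambda>h. h *\<^sub>C D)) (at w))"

definition single_valued_extension_property :: "('a::complex_hilbert_space \<Rightarrow> 'a) \<Rightarrow> bool"
  where "single_valued_extension_property T \<longleftrightarrow>
    (\<forall>U f. open U \<longrightarrow> hilbert_analytic_on f U \<longrightarrow> (\<forall>z\<in>U. T (f z) - z *\<^sub>C f z = 0) \<longrightarrow>
       (\<forall>z\<in>U. f z = 0))"

end

theory Submission imports Defs begin

text \<open>Write \<open>N = T\<^sup>n\<close> and let \<open>E \<mu>\<close> be the eigenspace of \<open>N\<close> for an eigenvalue \<open>\<mu> \<noteq> 0\<close>.
  On \<open>E \<mu>\<close> the operator \<open>T\<close> is invertible, because \<open>T\<^sup>n = \<mu>\<close> there; and \<open>T\<^sup>*T\<close> maps \<open>E \<mu>\<close> into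
  itself, because it commutes with \<open>N\<close>. Hence \<open>T\<^sup>*\<close> maps \<open>E \<mu>\<close> into itself as well (lemma
  \<open>adjoint_preserves_eigenspace\<close>), so \<open>E \<mu>\<close> reduces \<open>N\<close>, and \<open>N\<^sup>*\<close> acts on \<open>E \<mu>\<close> as the
  adjoint of \<open>N\<close> restricted to \<open>E \<mu>\<close>, that is, as the scalar \<open>cnj \<mu>\<close> (lemma
  \<open>adjoint_power_eigenvector\<close>). The usual computation then shows that eigenvectors of \<open>N\<close> for
  distinct eigenvalues are orthogonal; one of the two eigenvalues is automatically nonzero.

  If now \<open>T (f z) = z f(z)\<close> on an open set, then \<open>f z\<close> and \<open>f w\<close> lie in the eigenspaces of \<open>N\<close> for
  \<open>z\<^sup>n\<close> and \<open>w\<^sup>n\<close>. For \<open>w \<noteq> z\<close> close to \<open>z\<close> these numbers differ, so \<open>f w\<close> is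
  orthogonal to \<open>f z\<close> and \<open>\<parallel>f w - f z\<parallel> \<ge> \<parallel>f z\<parallel>\<close>. Continuity of \<open>f\<close> at \<open>z\<close> forces
  \<open>f z = 0\<close>.

  The adjoint is defined by a definite description, so its existence has to be established. This is
  the Riesz representation theorem, proved by minimising \<open>\<parallel>x\<parallel>\<^sup>2 - 2 \<phi>(x)\<close>.\<close>

section \<open>The inner product\<close>

lemma cinner_add_right: "cinner x (y + z) = cinner x y + cinner x z"
  by (metis cinner_commute cinner_add_left complex_cnj_add)

lemma cinner_scaleC_right: "cinner x (c *\<^sub>C y) = cnj c * cinner x y"
  by (metis cinner_commute cinner_scaleC_left complex_cnj_mult)

lemma cinner_zero_left [simp]: "cinner 0 x = 0"
  using cinner_add_left[of 0 0 x] by simp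

lemma cinner_zero_right [simp]: "cinner x 0 = 0"
  using cinner_add_right[of x 0 0] by simp

lemma cinner_minus_left: "cinner (- x) y = - cinner x y"
  by (metis add.right_inverse cinner_add_left cinner_zero_left minus_unique)

lemma cinner_minus_right: "cinner x (- y) = - cinner x y"
  by (metis add.right_inverse cinner_add_right cinner_zero_right minus_unique)

lemma cinner_diff_left: "cinner (x - y) z = cinner x z - cinner y z"
  using cinner_add_left[of x "- y" z] by (simp add: cinner_minus_left)

lemma cinner_diff_right: "cinner x (y - z) = cinner x y - cinner x z"
  using cinner_add_right[of x y "- z"] by (simp add: cinner_minus_right)

lemma cinner_self_eq_0_iff: "cinner x x = 0 \<longleftrightarrow> x = 0"
  by (simp add: cinner_self)

lemma cinner_right_eqI:
  assumes "\<And>x. cinner x y = cinner x z"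
  shows "y = z"
proof -
  have "cinner (y - z) (y - z) = 0"
    using assms by (simp add: cinner_diff_right)
  then show ?thesis
    by (simp add: cinner_self_eq_0_iff)
qed

lemma Re_cinner_commute: "Re (cinner x y) = Re (cinner y x)"
  by (subst cinner_commute) simp

lemma norm_add_sq: "(norm (x + y))\<^sup>2 = (norm x)\<^sup>2 + 2 * Re (cinner x y) + (norm y)\<^sup>2"
proof -
  have "(norm (x + y))\<^sup>2 = Re (cinner (x + y) (x + y))"
    by (simp add: cinner_self)
  also have "\<dots> = Re (cinner x x) + Re (cinner x y) + (Re (cinner y x) + Re (cinner y y))"
    by (simp add: cinner_add_left cinner_add_right)
  finally show ?thesis
    using Re_cinner_commute[of x y] by (simp add: cinner_self)
qed

lemma norm_diff_sq: "(norm (x - y))\<^sup>2 = (norm x)\<^sup>2 - 2 * Re (cinner x y) + (norm y)\<^sup>2"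
  using norm_add_sq[of x "- y"] by (simp add: cinner_minus_right)

lemma parallelogram_law:
  fixes x y :: "'a::complex_hilbert_space"
  shows "(norm (x + y))\<^sup>2 + (norm (x - y))\<^sup>2 = 2 * (norm x)\<^sup>2 + 2 * (norm y)\<^sup>2"
  by (simp add: norm_add_sq norm_diff_sq)

lemma Re_cinner_scaleR_left: "Re (cinner (r *\<^sub>R x) y) = r * Re (cinner x y)"
  by (simp add: scaleR_scaleC cinner_scaleC_left)

lemma Re_cinner_scaleR_right: "Re (cinner x (r *\<^sub>R y)) = r * Re (cinner x y)"
  by (simp add: scaleR_scaleC cinner_scaleC_right)

lemma Re_cinner_Cauchy_Schwarz: "\<bar>Re (cinner x y)\<bar> \<le> norm x * norm y"
proof (cases "y = 0")
  case False
  define t where "t = Re (cinner x y) / (norm y)\<^sup>2"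
  have "0 \<le> (norm (x - t *\<^sub>R y))\<^sup>2"
    by simp
  also have "\<dots> = (norm x)\<^sup>2 - 2 * t * Re (cinner x y) + t\<^sup>2 * (norm y)\<^sup>2"
    by (simp add: norm_diff_sq Re_cinner_scaleR_right power_mult_distrib)
  also have "\<dots> = (norm x)\<^sup>2 - (Re (cinner x y))\<^sup>2 / (norm y)\<^sup>2"
    using False by (simp add: t_def field_simps power2_eq_square)
  finally have "(Re (cinner x y))\<^sup>2 \<le> (norm x * norm y)\<^sup>2"
    using False by (simp add: field_simps)
  then show ?thesis
    by (simp add: abs_le_square_iff[symmetric] abs_mult)
qed simp

section \<open>Riesz representation and the adjoint\<close>

lemma bounded_linear_Re_cinner_left:
  fixes y :: "'a::complex_hilbert_space"
  shows "bounded_linear (\<lambda>x. Re (cinner x y))"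
  by (rule bounded_linear_intro[where K = "norm y"])
    (use Re_cinner_Cauchy_Schwarz in \<open>auto simp: cinner_add_left Re_cinner_scaleR_left\<close>)

text \<open>The representing vector is the minimiser of \<open>\<parallel>x\<parallel>\<^sup>2 - 2 \<phi>(x)\<close>; by the parallelogram law every
  minimising sequence of this functional is Cauchy.\<close>

lemma Riesz_representation_Re:
  fixes \<phi> :: "'a::complex_hilbert_space \<Rightarrow> real"
  assumes "bounded_linear \<phi>"
  obtains u where "\<And>x. \<phi> x = Re (cinner x u)"
proof -
  interpret bounded_linear \<phi> by fact
  define J where "J x = (norm x)\<^sup>2 - 2 * \<phi> x" for x
  obtain K where K: "\<And>x. norm (\<phi> x) \<le> norm x * K"
    using bounded by blast
  have "- K\<^sup>2 \<le> J x" for x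
  proof -
    have "\<phi> x \<le> norm x * K"
      using K[of x] by simp
    moreover have "0 \<le> (norm x - K)\<^sup>2"
      by simp
    ultimately show ?thesis
      unfolding J_def power2_diff by linarith
  qed
  then have bdd: "bdd_below (range J)"
    by (intro bdd_belowI[of _ "- K\<^sup>2"]) auto
  define m where "m = Inf (range J)"
  have m_le: "m \<le> J x" for x
    unfolding m_def using bdd by (simp add: cInf_lower)
  have "\<exists>x. J x < m + inverse (real (Suc k))" for k
    using cInf_lessD[of "range J" "m + inverse (real (Suc k))"] by (auto simp: m_def)
  then obtain X where X: "\<And>k. J (X k) < m + inverse (real (Suc k))"
    by metis
  have mid: "(norm (x - y))\<^sup>2 \<le> 2 * (J x - m) + 2 * (J y - m)" for x y
  proof -
    have "(norm ((1/2) *\<^sub>R (x + y)))\<^sup>2 = (norm (x + y))\<^sup>2 / 4"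
      unfolding norm_scaleR power_mult_distrib by (simp add: power2_eq_square)
    moreover have "\<phi> ((1/2) *\<^sub>R (x + y)) = (\<phi> x + \<phi> y) / 2"
      unfolding scaleR add by simp
    ultimately have "4 * m \<le> (norm (x + y))\<^sup>2 - 4 * (\<phi> x + \<phi> y)"
      using m_le[of "(1/2) *\<^sub>R (x + y)"] by (simp add: J_def)
    then show ?thesis
      using parallelogram_law[of x y] by (simp add: J_def)
  qed
  have "Cauchy X"
  proof (rule metric_CauchyI)
    fix e :: real
    assume "0 < e"
    then obtain M where M: "inverse (real (Suc M)) < e\<^sup>2 / 4"
      using reals_Archimedean[of "e\<^sup>2 / 4"] by auto
    have close: "J (X k) - m < e\<^sup>2 / 4" if "k \<ge> M" for k
    proof -
      have "inverse (real (Suc k)) \<le> inverse (real (Suc M))"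
        using that by (intro le_imp_inverse_le) auto
      then show ?thesis
        using X[of k] M by linarith
    qed
    have "dist (X k) (X l) < e" if "k \<ge> M" "l \<ge> M" for k l
    proof -
      have "(norm (X k - X l))\<^sup>2 \<le> 2 * (J (X k) - m) + 2 * (J (X l) - m)"
        by (rule mid)
      also have "\<dots> < e\<^sup>2"
        using close[OF that(1)] close[OF that(2)] by simp
      finally have "(norm (X k - X l))\<^sup>2 < e\<^sup>2" .
      then show ?thesis
        using \<open>0 < e\<close> by (simp add: dist_norm power_less_imp_less_base)
    qed
    then show "\<exists>M. \<forall>k\<ge>M. \<forall>l\<ge>M. dist (X k) (X l) < e"
      by blast
  qed
  then obtain u where u: "X \<longlonglongrightarrow> u"
    using Cauchy_convergent_iff convergent_def by blast
  have "(\<lambda>k. J (X k)) \<longlonglongrightarrow> J u"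
    unfolding J_def by (intro tendsto_intros tendsto u)
  moreover have "(\<lambda>k. m + inverse (real (Suc k))) \<longlonglongrightarrow> m"
    using tendsto_add[OF tendsto_const LIMSEQ_inverse_real_of_nat] by force
  ultimately have "J u \<le> m"
    by (rule LIMSEQ_le) (use X less_imp_le in blast)
  then have min: "J u \<le> J x" for x
    using m_le[of x] by linarith
  have "\<phi> h = Re (cinner h u)" for h
  proof -
    define d where "d = Re (cinner u h) - \<phi> h"
    have quad: "0 \<le> 2 * t * d + t\<^sup>2 * (norm h)\<^sup>2" for t
      using min[of "u + t *\<^sub>R h"]
      by (simp add: J_def d_def norm_add_sq Re_cinner_scaleR_right add scaleR algebra_simps)
    have "d = 0"
    proof (cases "h = 0")
      case True
      then show ?thesis
        by (simp add: d_def)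
    next
      case False
      \<comment> \<open>the quadratic polynomial in \<open>t\<close> is tested at its vertex\<close>
      have "0 \<le> - (d\<^sup>2 / (norm h)\<^sup>2)"
        using quad[of "- d / (norm h)\<^sup>2"] False by (simp add: field_simps power2_eq_square)
      then show ?thesis
        using False by (simp add: field_simps)
    qed
    then show ?thesis
      using Re_cinner_commute[of u h] by (simp add: d_def)
  qed
  then show thesis
    using that by blast
qed

lemma cadjoint_exists:
  fixes T :: "'a::complex_hilbert_space \<Rightarrow> 'a"
  assumes "bounded_clinear T"
  shows "\<exists>S. \<forall>x y. cinner (T x) y = cinner x (S y)"
proof -
  have bl: "bounded_linear T" and cl: "\<And>c x. T (c *\<^sub>C x) = c *\<^sub>C T x"
    using assms by (auto simp: bounded_clinear_def)
  have "\<exists>u. \<forall>x. cinner (T x) y = cinner x u" for y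
  proof -
    have "bounded_linear (\<lambda>x. Re (cinner (T x) y))"
      by (rule bounded_linear_compose[OF bounded_linear_Re_cinner_left bl])
    then obtain u where u: "\<And>x. Re (cinner (T x) y) = Re (cinner x u)"
      using Riesz_representation_Re by blast
    \<comment> \<open>replacing \<open>x\<close> by \<open>- i x\<close> turns real parts into imaginary parts\<close>
    have "Im (cinner (T x) y) = Im (cinner x u)" for x
      using u[of "(- \<i>) *\<^sub>C x"] by (simp only: cl cinner_scaleC_left) simp
    with u have "\<forall>x. cinner (T x) y = cinner x u"
      by (simp add: complex_eq_iff)
    then show ?thesis ..
  qed
  then have "\<exists>S. \<forall>y x. cinner (T x) y = cinner x (S y)"
    by (intro choice allI)
  then show ?thesis
    by blast
qed

lemma cinner_cadjoint:
  fixes T :: "'a::complex_hilbert_space \<Rightarrow> 'a"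
  assumes "bounded_clinear T"
  shows "cinner (T x) y = cinner x (cadjoint T y)"
proof -
  have "\<exists>!S. \<forall>x y. cinner (T x) y = cinner x (S y)"
  proof (rule ex_ex1I)
    show "\<exists>S. \<forall>x y. cinner (T x) y = cinner x (S y)"
      by (rule cadjoint_exists) fact
  next
    fix S S'
    assume S: "\<forall>x y. cinner (T x) y = cinner x (S y)"
      and S': "\<forall>x y. cinner (T x) y = cinner x (S' y)"
    show "S = S'"
    proof (rule ext, rule cinner_right_eqI)
      show "cinner x (S y) = cinner x (S' y)" for x y
        using S S' by metis
    qed
  qed
  from theI'[OF this] show ?thesis
    unfolding cadjoint_def by blast
qed

lemma cadjoint_scaleC:
  assumes "bounded_clinear T"
  shows "cadjoint T (c *\<^sub>C y) = c *\<^sub>C cadjoint T y"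
  by (rule cinner_right_eqI) (simp add: cinner_scaleC_right flip: cinner_cadjoint[OF assms])

lemma cinner_cadjoint_funpow:
  assumes "bounded_clinear T"
  shows "cinner ((T ^^ k) x) y = cinner x ((cadjoint T ^^ k) y)"
proof (induction k arbitrary: y)
  case (Suc k)
  then show ?case
    by (simp add: cinner_cadjoint[OF assms]) (simp add: funpow_swap1)
qed simp

section \<open>Eigenspaces of the power\<close>

lemma bounded_clinear_funpow_scaleC:
  assumes "bounded_clinear T"
  shows "(T ^^ k) (c *\<^sub>C x) = c *\<^sub>C (T ^^ k) x"
  using assms by (induction k) (auto simp: bounded_clinear_def)

lemma bounded_clinear_funpow_diff:
  assumes "bounded_clinear T"
  shows "(T ^^ k) (x - y) = (T ^^ k) x - (T ^^ k) y"
  using assms by (induction k) (auto simp: bounded_clinear_def bounded_linear.linear linear_diff)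

lemma funpow_eigenvector:
  assumes "bounded_clinear T" "T x = z *\<^sub>C x"
  shows "(T ^^ k) x = z ^ k *\<^sub>C x"
  using assms
  by (induction k) (auto simp: bounded_clinear_def scaleC_one scaleC_scaleC mult.commute)

lemma adjoint_preserves_eigenspace:
  fixes T :: "'a::complex_hilbert_space \<Rightarrow> 'a"
  assumes T: "bounded_clinear T" and q: "power_quasinormal n T" and "n \<ge> 1"
    and u: "(T ^^ n) u = \<mu> *\<^sub>C u" and "\<mu> \<noteq> 0"
  shows "(T ^^ n) (cadjoint T u) = \<mu> *\<^sub>C cadjoint T u"
proof -
  have comm: "(T ^^ n) (cadjoint T (T x)) = cadjoint T (T ((T ^^ n) x))" for x
    using q unfolding power_quasinormal_def by (metis comp_apply)
  \<comment> \<open>the preimage of \<open>u\<close> under \<open>T\<close> inside the eigenspace\<close>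
  define v where "v = inverse \<mu> *\<^sub>C (T ^^ (n - 1)) u"
  have "T ((T ^^ (n - 1)) u) = (T ^^ n) u"
    using \<open>n \<ge> 1\<close> by (cases n) auto
  then have Tv: "T v = u"
    using T u \<open>\<mu> \<noteq> 0\<close> by (simp add: v_def bounded_clinear_def scaleC_scaleC scaleC_one)
  have "(T ^^ n) (cadjoint T u) = cadjoint T (T ((T ^^ n) v))"
    using comm[of v] Tv by simp
  also have "T ((T ^^ n) v) = (T ^^ n) u"
    using Tv by (simp add: funpow_swap1)
  finally show ?thesis
    by (simp add: u cadjoint_scaleC[OF T])
qed

text \<open>The vector \<open>(T\<^sup>*)\<^sup>n u - cnj \<mu> u\<close> lies in the eigenspace of \<open>T\<^sup>n\<close> for \<open>\<mu>\<close> and is orthogonal to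
  that eigenspace, so it vanishes.\<close>

lemma adjoint_power_eigenvector:
  fixes T :: "'a::complex_hilbert_space \<Rightarrow> 'a"
  assumes T: "bounded_clinear T" and "power_quasinormal n T" "n \<ge> 1"
    and u: "(T ^^ n) u = \<mu> *\<^sub>C u" and "\<mu> \<noteq> 0"
  shows "(cadjoint T ^^ n) u = cnj \<mu> *\<^sub>C u"
proof -
  have S: "(T ^^ n) ((cadjoint T ^^ k) u) = \<mu> *\<^sub>C (cadjoint T ^^ k) u" for k
    by (induction k) (use assms adjoint_preserves_eigenspace in auto)
  define d where "d = (cadjoint T ^^ n) u - cnj \<mu> *\<^sub>C u"
  have mu_diff: "\<mu> *\<^sub>C (x - y) = \<mu> *\<^sub>C x - \<mu> *\<^sub>C y" for x y :: 'a
    using scaleC_add_right[of \<mu> "x - y" y] by (simp add: algebra_simps)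
  have "(T ^^ n) d = \<mu> *\<^sub>C d"
    by (simp add: d_def bounded_clinear_funpow_diff[OF T] bounded_clinear_funpow_scaleC[OF T]
        S u mu_diff scaleC_scaleC mult.commute)
  then have "cinner d ((cadjoint T ^^ n) u) = \<mu> * cinner d u"
    by (simp add: cinner_scaleC_left flip: cinner_cadjoint_funpow[OF T])
  moreover have "cinner d (cnj \<mu> *\<^sub>C u) = \<mu> * cinner d u"
    by (simp add: cinner_scaleC_right)
  ultimately have "cinner d d = 0"
    by (subst (2) d_def) (simp add: cinner_diff_right)
  then show ?thesis
    by (simp add: cinner_self_eq_0_iff d_def)
qed

lemma power_eigenvectors_orthogonal:
  fixes T :: "'a::complex_hilbert_space \<Rightarrow> 'a"
  assumes T: "bounded_clinear T" and q: "power_quasinormal n T" "n \<ge> 1"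
    and x: "(T ^^ n) x = \<nu> *\<^sub>C x" and y: "(T ^^ n) y = \<mu> *\<^sub>C y" and "\<nu> \<noteq> \<mu>"
  shows "cinner x y = 0"
proof -
  have *: "cinner a b = 0"
    if a: "(T ^^ n) a = \<alpha> *\<^sub>C a" and b: "(T ^^ n) b = \<beta> *\<^sub>C b" and "\<alpha> \<noteq> \<beta>" "\<beta> \<noteq> 0" for a b \<alpha> \<beta>
  proof -
    have "\<alpha> * cinner a b = cinner ((T ^^ n) a) b"
      by (simp add: a cinner_scaleC_left)
    also have "\<dots> = \<beta> * cinner a b"
      by (simp add: cinner_cadjoint_funpow[OF T] cinner_scaleC_right
          adjoint_power_eigenvector[OF T q b \<open>\<beta> \<noteq> 0\<close>])
    finally show ?thesis
      using \<open>\<alpha> \<noteq> \<beta>\<close> by simp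
  qed
  show ?thesis
  proof (cases "\<mu> = 0")
    case True
    then have "cinner y x = 0"
      using * x y \<open>\<nu> \<noteq> \<mu>\<close> by metis
    then show ?thesis
      by (subst cinner_commute) simp
  next
    case False
    then show ?thesis
      using * x y \<open>\<nu> \<noteq> \<mu>\<close> by metis
  qed
qed

section \<open>The single-valued extension property\<close>

lemma eventually_power_neq:
  fixes z :: complex
  assumes "n \<ge> 1"
  shows "\<forall>\<^sub>F w in at z. w ^ n \<noteq> z ^ n"
proof -
  have "finite {w. w ^ n = z ^ n}"
    using assms by (intro finite_nth_roots) auto
  then have "\<not> z islimpt {w. w ^ n = z ^ n}"
    by (rule islimpt_finite)
  then show ?thesis
    by (simp add: islimpt_iff_eventually)
qed

theorem theorem2p12:
  fixes T :: "'a::complex_hilbert_space \<Rightarrow> 'a" and n :: nat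
  assumes "n \<ge> 1"
    and "bounded_clinear T"
    and "power_quasinormal n T"
  shows "single_valued_extension_property T"
  unfolding single_valued_extension_property_def
proof (intro allI impI ballI)
  fix U :: "complex set" and f :: "complex \<Rightarrow> 'a" and z
  assume U: "open U" and f: "hilbert_analytic_on f U"
    and eig: "\<forall>z\<in>U. T (f z) - z *\<^sub>C f z = 0" and z: "z \<in> U"
  have power: "(T ^^ n) (f w) = w ^ n *\<^sub>C f w" if "w \<in> U" for w
    using eig that by (intro funpow_eigenvector assms) simp
  obtain e where e: "e > 0" "\<forall>w\<in>ball z e. \<exists>D. (f has_derivative (\<lambda>h. h *\<^sub>C D)) (at w)"
    using f z unfolding hilbert_analytic_on_def by blast
  from e have "isCont f z"
    using has_derivative_continuous by (metis centre_in_ball)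
  then have lim: "(f \<longlongrightarrow> f z) (at z)"
    by (simp add: isCont_def)
  show "f z = 0"
  proof (rule ccontr)
    assume "f z \<noteq> 0"
    then have "\<forall>\<^sub>F w in at z. dist (f w) (f z) < norm (f z)"
      using lim by (intro tendstoD) auto
    moreover have "\<forall>\<^sub>F w in at z. w \<in> U"
      using U z by (rule eventually_at_in_open')
    moreover have "\<forall>\<^sub>F w in at z. w ^ n \<noteq> z ^ n"
      using \<open>n \<ge> 1\<close> by (rule eventually_power_neq)
    ultimately have "\<forall>\<^sub>F w in at z. False"
    proof eventually_elim
      case (elim w)
      have "cinner (f w) (f z) = 0"
        by (rule power_eigenvectors_orthogonal[OF assms(2,3,1)])
          (use power elim z in auto)
      then have "(norm (f z))\<^sup>2 \<le> (norm (f w - f z))\<^sup>2"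
        by (simp add: norm_diff_sq)
      then have "norm (f z) \<le> norm (f w - f z)"
        using power2_le_imp_le by auto
      then show False
        using elim by (simp add: dist_norm)
    qed
    then show False
      by simp
  qed
qed

end
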